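(* Assume the Inverse Shortcode Hypothesis (ISH) holds. Then the Degree 2 Shortcode Soundness Hypothesis (SSH) holds. (ISH): For every $\eta>0$ there exist $\delta>0$ and an integer $r$, depending only on $\eta$, such that for all $\ell,n$ and every subset $S\subseteq \mathsf{Mat}_{\ell,n}$: if $\Pr_{M\sim S,\,a\sim\mathbb{F}_2^{\ell},\,b\sim\mathbb{F}_2^{n}}[M+ab^{\top}\in S]\ge \eta$ (all samples uniform and independent), then there exists an $r$-nice set $T\subseteq\mathsf{Mat}_{\ell,n}$ with $|S\cap T|\ge \delta|T|$. (SSH): For every $\delta>0$ there exist $\epsilon>0$ and an integer $r>0$ such that the following holds for sufficiently large $n\gg\ell$. Let $F:\mathsf{Mat}_{\ell,n}\to\mathbb{F}_2^{\ell}$ satisfy $\Pr_{M\sim\mathsf{Mat}_{\ell,n},\,a\sim\mathbb{F}_2^{\ell},\,b\sim\mathbb{F}_2^{n}}[F(M+ab^{\top})\in\{F(M),F(M)+a\}]\ge\delta$. Then there exist $q_1,\dots,q_r\in\mathbb{F}_2^n$, $t_1,\dots,t_r\in\mathbb{F}_2^{\ell}$, $p_1,\dots,p_r\in\mathbb{F}_2^{\ell}$, $s_1,\dots,s_r\in\mathbb{F}_2^{n}$, $z\in\mathbb{F}_2^n$ and $u\in\mathbb{F}_2^{\ell}$ such that $$\Pr_{M\sim\mathsf{Mat}_{\ell,n}}\big[F(M)=Mz+u \;\big|\; Mq_i=t_i,\ p_i^{\top}M=s_i^{\top}\ \forall i\le r\big]\ge\epsilon.$$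
   Context: $\mathsf{Mat}_{\ell,n}$ denotes the set of all $\ell\times n$ matrices over $\mathbb{F}_2$; $M\sim X$ means $M$ is drawn uniformly from the finite set $X$. A right affine subspace of $\mathsf{Mat}_{\ell,n}$ is a set of the form $\{M: Mq_i=t_i,\ i=1,\dots,r_1\}$ with $q_i\in\mathbb{F}_2^n$, $t_i\in\mathbb{F}_2^{\ell}$; a left affine subspace is a set of the form $\{M: s_j^{\top}M=u_j^{\top},\ j=1,\dots,r_2\}$ with $s_j\in\mathbb{F}_2^{\ell}$, $u_j\in\mathbb{F}_2^n$. A subset $T\subseteq\mathsf{Mat}_{\ell,n}$ is $r$-nice if it is the intersection of a right affine subspace defined by $r_1$ such constraints and a left affine subspace defined by $r_2$ such constraints with $r_1+r_2=r$. *)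

theory Defs
  imports
    "HOL-Probability.Probability_Mass_Function"
    "HOL-Library.Z2"
    "Jordan_Normal_Form.Matrix"
begin

type_synonym bit_vec = "bit Matrix.vec"
type_synonym bit_mat = "bit Matrix.mat"

definition outer :: "bit_vec \<Rightarrow> bit_vec \<Rightarrow> bit_mat" where
  "outer a b = mat_of_cols (dim_vec a) [a] * mat_of_row b"

definition right_affine :: "nat \<Rightarrow> nat \<Rightarrow> nat \<Rightarrow> bit_mat set \<Rightarrow> bool" where
  "right_affine l n r A \<longleftrightarrow>
     (\<exists>q t. (\<forall>i<r. q i \<in> carrier_vec n \<and> t i \<in> carrier_vec l) \<and>
            A = {M \<in> carrier_mat l n. \<forall>i<r. M *\<^sub>v q i = t i})"

definition left_affine :: "nat \<Rightarrow> nat \<Rightarrow> nat \<Rightarrow> bit_mat set \<Rightarrow> bool" where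
  "left_affine l n r A \<longleftrightarrow>
     (\<exists>s u. (\<forall>j<r. s j \<in> carrier_vec l \<and> u j \<in> carrier_vec n) \<and>
            A = {M \<in> carrier_mat l n. \<forall>j<r. mat_of_row (s j) * M = mat_of_row (u j)})"

definition nice :: "nat \<Rightarrow> nat \<Rightarrow> nat \<Rightarrow> bit_mat set \<Rightarrow> bool" where
  "nice l n r T \<longleftrightarrow>
     (\<exists>r1 r2 A B. r1 + r2 = r \<and> right_affine l n r1 A \<and> left_affine l n r2 B \<and> T = A \<inter> B)"

text \<open>
  The product distribution below makes the three samples independent. The set \<open>S\<close> is nonempty so
  that a uniform sample from it exists. The set \<open>T\<close> is required to be nonempty: the constraints may
  be inconsistent, and the density bound would hold vacuously for \<open>T = {}\<close>.
\<close>

definition inverse_shortcode_hypothesis :: bool where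
  "inverse_shortcode_hypothesis \<longleftrightarrow>
     (\<forall>\<eta>::real. \<eta> > 0 \<longrightarrow> (\<exists>\<delta>::real. \<exists>r::nat. \<delta> > 0 \<and>
       (\<forall>l n. \<forall>S \<subseteq> carrier_mat l n. S \<noteq> {} \<longrightarrow>
          \<P>((M, a, b) in pair_pmf (pmf_of_set S)
               (pair_pmf (pmf_of_set (carrier_vec l)) (pmf_of_set (carrier_vec n))).
             M + outer a b \<in> S) \<ge> \<eta> \<longrightarrow>
          (\<exists>T. nice l n r T \<and> T \<noteq> {} \<and> real (card (S \<inter> T)) \<ge> \<delta> * real (card T)))))"

text \<open>
  ``Sufficiently large \<open>n \<gg> l\<close>'' means: for every \<open>l\<close> and every \<open>n\<close> beyond a threshold that may
  depend on \<open>l\<close> (and on \<open>\<delta>\<close>, \<open>\<epsilon>\<close>, \<open>r\<close>). A conditional probability given an event of probability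
  \<open>0\<close> is \<open>0\<close>, so the lower bound \<open>\<epsilon> > 0\<close> forces the constraints to be satisfiable.
\<close>

definition degree2_shortcode_soundness_hypothesis :: bool where
  "degree2_shortcode_soundness_hypothesis \<longleftrightarrow>
     (\<forall>\<delta>::real. \<delta> > 0 \<longrightarrow> (\<exists>\<epsilon>::real. \<exists>r::nat. \<epsilon> > 0 \<and> r > 0 \<and>
       (\<forall>l. \<exists>n0. \<forall>n \<ge> n0. \<forall>F \<in> carrier_mat l n \<rightarrow> carrier_vec l.
          \<P>((M, a, b) in pair_pmf (pmf_of_set (carrier_mat l n))
               (pair_pmf (pmf_of_set (carrier_vec l)) (pmf_of_set (carrier_vec n))).
             F (M + outer a b) \<in> {F M, F M + a}) \<ge> \<delta> \<longrightarrow>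
          (\<exists>q t p s z u.
             (\<forall>i<r. q i \<in> carrier_vec n \<and> t i \<in> carrier_vec l \<and>
                    p i \<in> carrier_vec l \<and> s i \<in> carrier_vec n) \<and>
             z \<in> carrier_vec n \<and> u \<in> carrier_vec l \<and>
             \<P>(M in pmf_of_set (carrier_mat l n).
                F M = M *\<^sub>v z + u \<bar>
                (\<forall>i<r. M *\<^sub>v q i = t i \<and> mat_of_row (p i) * M = mat_of_row (s i))) \<ge> \<epsilon>))))"

end

theory Submission
  imports Defs
begin

text \<open>
  Append \<open>F M\<close> as a last column to \<open>M\<close> and let \<open>S\<close> be the set of all matrices obtained in this
  way. Given a successful test \<open>(M, a, b)\<close>, one of the two values of an extra last bit of \<open>b\<close>
  keeps \<open>(M | F M)\<close> inside \<open>S\<close>, so \<open>S\<close> passes the inverse shortcode test with probability at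
  least \<open>\<delta> / 2\<close>. A nonempty nice set of extended matrices has the form
  \<open>{(M | M z + w). M \<in> D, w \<in> W}\<close> with \<open>D\<close> nice: if some right constraint involves the last column
  then it determines \<open>z\<close> and \<open>w\<close>, and otherwise \<open>z = 0\<close> works. As \<open>S\<close> has density at least \<open>\<delta>'\<close>
  in this set, by averaging over \<open>W\<close> there is one \<open>w\<close> such that \<open>F M = M z + w\<close> for at least a
  fraction \<open>\<delta>'\<close> of the \<open>M \<in> D\<close>.
\<close>

unbundle no vec_syntax
unbundle no inner_syntax

subsection \<open>Uniform distributions\<close>

lemma pair_pmf_of_set:
  assumes "finite A" "A \<noteq> {}" "finite B" "B \<noteq> {}"
  shows "pair_pmf (pmf_of_set A) (pmf_of_set B) = pmf_of_set (A \<times> B)"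
proof (rule pmf_eqI)
  fix x :: "'a \<times> 'b"
  show "pmf (pair_pmf (pmf_of_set A) (pmf_of_set B)) x = pmf (pmf_of_set (A \<times> B)) x"
    using assms by (cases x) (auto simp: pmf_pair card_cartesian_product indicator_def)
qed

lemma prob_pmf_of_set:
  assumes "finite A" "A \<noteq> {}"
  shows "\<P>(x in measure_pmf (pmf_of_set A). P x) = real (card {x \<in> A. P x}) / real (card A)"
proof -
  have "A \<inter> {x. P x} = {x \<in> A. P x}" by auto
  then show ?thesis using measure_pmf_of_set[OF assms(2,1), of "{x. P x}"] by simp
qed

lemma prob_pmf_of_set_triple:
  assumes "finite A" "A \<noteq> {}" "finite B" "B \<noteq> {}" "finite C" "C \<noteq> {}"
  shows "\<P>((x, y, z) in pair_pmf (pmf_of_set A) (pair_pmf (pmf_of_set B) (pmf_of_set C)). P x y z)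
       = real (card {t \<in> A \<times> B \<times> C. case t of (x, y, z) \<Rightarrow> P x y z}) / real (card (A \<times> B \<times> C))"
proof -
  have "pair_pmf (pmf_of_set A) (pair_pmf (pmf_of_set B) (pmf_of_set C)) = pmf_of_set (A \<times> B \<times> C)"
    using assms by (simp add: pair_pmf_of_set)
  moreover have "finite (A \<times> B \<times> C)" "A \<times> B \<times> C \<noteq> {}" using assms by auto
  ultimately show ?thesis
    using prob_pmf_of_set[of "A \<times> B \<times> C" "\<lambda>(x, y, z). P x y z"] by (simp add: case_prod_unfold)
qed

text \<open>The factor \<open>card A\<close> cancels from the quotient of the two probabilities. If
  \<open>Q\<close> never holds on \<open>A\<close>, both sides are 0, since division by 0 gives
  0.\<close>

lemma cond_prob_pmf_of_set:
  assumes "finite A" "A \<noteq> {}"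
  shows "\<P>(x in measure_pmf (pmf_of_set A). P x \<bar> Q x)
       = real (card {x \<in> A. P x \<and> Q x}) / real (card {x \<in> A. Q x})"
  unfolding cond_prob_def prob_pmf_of_set[OF assms] using assms by simp

section \<open>Finiteness of the spaces of vectors and matrices over F_2\<close>

lemma finite_carrier_bit_vec: "finite (carrier_vec n :: bit_vec set)"
proof -
  have "(carrier_vec n :: bit_vec set) \<subseteq> Matrix.vec n ` ({..<n} \<rightarrow>\<^sub>E (UNIV :: bit set))"
  proof
    fix v :: bit_vec assume "v \<in> carrier_vec n"
    then show "v \<in> Matrix.vec n ` ({..<n} \<rightarrow>\<^sub>E (UNIV :: bit set))"
      by (intro image_eqI[of _ _ "restrict (vec_index v) {..<n}"] eq_vecI) auto
  qed
  moreover have "finite (UNIV :: bit set)"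
  proof (rule finite_subset)
    show "(UNIV :: bit set) \<subseteq> {0, 1}"
    proof
      fix x :: bit show "x \<in> {0, 1}" by (cases x) simp_all
    qed
  qed simp
  ultimately show ?thesis by (metis finite_subset finite_imageI finite_PiE finite_lessThan)
qed

lemma finite_carrier_bit_mat: "finite (carrier_mat l n :: bit_mat set)"
proof -
  \<comment> \<open>A matrix is encoded by its family of rows. The default
    \<open>0\<^sub>v n\<close> for indices from \<open>l\<close> on gives all families a common
    value outside a finite index set, as \<open>finite_set_of_finite_funs\<close> requires.\<close>
  have "inj_on (\<lambda>A i. if i < l then Matrix.row A i else 0\<^sub>v n) (carrier_mat l n :: bit_mat set)"
  proof (rule inj_onI)
    fix A B :: bit_mat
    assume A: "A \<in> carrier_mat l n" and B: "B \<in> carrier_mat l n"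
      and eq: "(\<lambda>i. if i < l then Matrix.row A i else 0\<^sub>v n)
             = (\<lambda>i. if i < l then Matrix.row B i else 0\<^sub>v n)"
    have "Matrix.row A i = Matrix.row B i" if "i < l" for i
      using fun_cong[OF eq, of i] that by simp
    then show "A = B" using A B by (intro eq_rowI) auto
  qed
  moreover have "(\<lambda>A i. if i < l then Matrix.row A i else 0\<^sub>v n) ` (carrier_mat l n :: bit_mat set)
    \<subseteq> {f. \<forall>i. (i \<in> {..<l} \<longrightarrow> f i \<in> carrier_vec n) \<and> (i \<notin> {..<l} \<longrightarrow> f i = 0\<^sub>v n)}"
    by auto
  ultimately show ?thesis
    using finite_set_of_finite_funs[OF finite_lessThan finite_carrier_bit_vec]
    by (meson finite_imageD finite_subset)
qed

lemma carrier_vec_nonempty: "carrier_vec n \<noteq> {}"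
  using vec_carrier by blast

lemma carrier_mat_nonempty: "carrier_mat l n \<noteq> {}"
  using mat_carrier by blast

lemmas finite_nonempty_carriers =
  finite_carrier_bit_vec finite_carrier_bit_mat carrier_vec_nonempty carrier_mat_nonempty

subsection \<open>Appending a column\<close>

definition append_col :: "'a Matrix.mat \<Rightarrow> 'a Matrix.vec \<Rightarrow> 'a Matrix.mat" where
  "append_col M y = Matrix.mat (dim_row M) (Suc (dim_col M))
     (\<lambda>(i, j). if j < dim_col M then M $$ (i, j) else y $ i)"

definition vec_snoc :: "'a Matrix.vec \<Rightarrow> 'a \<Rightarrow> 'a Matrix.vec" where
  "vec_snoc v c = Matrix.vec (Suc (dim_vec v)) (\<lambda>i. if i < dim_vec v then v $ i else c)"

lemma dim_append_col [simp]:
  "dim_row (append_col M y) = dim_row M" "dim_col (append_col M y) = Suc (dim_col M)"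
  by (simp_all add: append_col_def)

lemma dim_vec_snoc [simp]: "dim_vec (vec_snoc v c) = Suc (dim_vec v)"
  by (simp add: vec_snoc_def)

lemma append_col_carrier [simp]:
  "M \<in> carrier_mat l n \<Longrightarrow> append_col M y \<in> carrier_mat l (Suc n)"
  by (auto simp: append_col_def)

lemma vec_snoc_carrier [simp]: "v \<in> carrier_vec n \<Longrightarrow> vec_snoc v c \<in> carrier_vec (Suc n)"
  by (auto simp: vec_snoc_def)

lemma index_append_col:
  assumes "M \<in> carrier_mat l n" "i < l" "j < Suc n"
  shows "append_col M y $$ (i, j) = (if j < n then M $$ (i, j) else y $ i)"
  using assms by (auto simp: append_col_def)

lemma append_col_inject:
  assumes "M \<in> carrier_mat l n" "M' \<in> carrier_mat l n" "y \<in> carrier_vec l" "y' \<in> carrier_vec l"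
    and eq: "append_col M y = append_col M' y'"
  shows "M = M' \<and> y = y'"
proof
  have *: "append_col M y $$ (i, j) = append_col M' y' $$ (i, j)" for i j
    by (simp add: eq)
  show "M = M'"
  proof (rule eq_matI)
    fix i j assume "i < dim_row M'" "j < dim_col M'"
    then show "M $$ (i, j) = M' $$ (i, j)"
      using *[of i j] assms(1,2) by (auto simp: index_append_col)
  qed (use assms in auto)
  show "y = y'"
  proof (rule eq_vecI)
    fix i assume "i < dim_vec y'"
    then show "y $ i = y' $ i"
      using *[of i n] assms(1-4) by (auto simp: index_append_col)
  qed (use assms in auto)
qed

lemma append_col_cases:
  assumes "A \<in> carrier_mat l (Suc n)"
  obtains M y where "M \<in> carrier_mat l n" "y \<in> carrier_vec l" "A = append_col M y"
proof
  let ?M = "Matrix.mat l n (\<lambda>ij. A $$ ij)" and ?y = "Matrix.vec l (\<lambda>i. A $$ (i, n))"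
  show "?M \<in> carrier_mat l n" "?y \<in> carrier_vec l" by auto
  show "A = append_col ?M ?y"
    using assms by (intro eq_matI) (auto simp: append_col_def less_Suc_eq)
qed

lemma vec_snoc_inject:
  assumes "v \<in> carrier_vec n" "v' \<in> carrier_vec n" and eq: "vec_snoc v c = vec_snoc v' c'"
  shows "v = v' \<and> c = c'"
proof
  have *: "vec_snoc v c $ i = vec_snoc v' c' $ i" for i by (simp add: eq)
  show "v = v'"
  proof (rule eq_vecI)
    fix i assume "i < dim_vec v'"
    then show "v $ i = v' $ i" using *[of i] assms(1,2) by (auto simp: vec_snoc_def)
  qed (use assms in auto)
  show "c = c'" using *[of n] assms(1,2) by (auto simp: vec_snoc_def)
qed

text \<open>Splitting off the last bit is a bijection onto pairs. This factor 2 is the only source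
  of the loss from \<delta> to \<open>\<delta> / 2\<close> in the test for the graph.\<close>

lemma card_carrier_bit_vec_Suc:
  "card (carrier_vec (Suc n) :: bit_vec set) = 2 * card (carrier_vec n :: bit_vec set)"
proof -
  have "bij_betw (\<lambda>(v, c). vec_snoc v c) (carrier_vec n \<times> {0, 1 :: bit}) (carrier_vec (Suc n))"
    unfolding bij_betw_def
  proof
    show "inj_on (\<lambda>(v, c). vec_snoc v c) (carrier_vec n \<times> {0, 1 :: bit})"
    proof (rule inj_onI, clarify)
      fix v v' :: bit_vec and c c' :: bit
      assume "v \<in> carrier_vec n" "v' \<in> carrier_vec n" "vec_snoc v c = vec_snoc v' c'"
      then show "v = v' \<and> c = c'" by (rule vec_snoc_inject)
    qed
    show "(\<lambda>(v, c). vec_snoc v c) ` (carrier_vec n \<times> {0, 1 :: bit}) = carrier_vec (Suc n)"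
    proof (intro equalityI subsetI)
      fix q :: bit_vec assume q: "q \<in> carrier_vec (Suc n)"
      then have "q = vec_snoc (vec_first q n) (q $ n)"
        by (intro eq_vecI) (auto simp: vec_snoc_def vec_first_def less_Suc_eq)
      moreover have "q $ n \<in> {0, 1}" by (cases "q $ n") simp_all
      ultimately show "q \<in> (\<lambda>(v, c). vec_snoc v c) ` (carrier_vec n \<times> {0, 1 :: bit})"
        by (intro image_eqI[of _ _ "(vec_first q n, q $ n)"] SigmaI) simp_all
    qed auto
  qed
  from bij_betw_same_card[OF this] show ?thesis by (simp add: card_cartesian_product)
qed

section \<open>Rank-one matrices and linear constraints in the presence of an extra column\<close>

lemma index_outer:
  assumes "i < dim_vec a" "j < dim_vec b"
  shows "outer a b $$ (i, j) = a $ i * b $ j"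
  using assms by (simp add: outer_def mat_of_cols_def mat_of_row_def scalar_prod_def)

lemma dim_outer [simp]: "dim_row (outer a b) = dim_vec a" "dim_col (outer a b) = dim_vec b"
  by (simp_all add: outer_def)

lemma outer_carrier [simp]:
  "a \<in> carrier_vec l \<Longrightarrow> b \<in> carrier_vec n \<Longrightarrow> outer a b \<in> carrier_mat l n"
  by (auto simp: outer_def)

text \<open>The last column of \<open>outer a (vec_snoc b c)\<close> is \<open>c\<close> times
  \<open>a\<close>. The extra bit thus chooses between keeping \<open>y\<close> and moving it to
  \<open>y + a\<close>, which are the two outcomes that the test for \<open>F\<close>
  accepts.\<close>

lemma append_col_add_outer:
  assumes "M \<in> carrier_mat l n" "y \<in> carrier_vec l" "a \<in> carrier_vec l" "b \<in> carrier_vec n"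
  shows "append_col M y + outer a (vec_snoc b c) = append_col (M + outer a b) (y + c \<cdot>\<^sub>v a)"
proof (rule eq_matI)
  have dims: "dim_row M = l" "dim_col M = n" "dim_vec y = l" "dim_vec a = l" "dim_vec b = n"
    using assms by auto
  fix i j assume "i < dim_row (append_col (M + outer a b) (y + c \<cdot>\<^sub>v a))"
    "j < dim_col (append_col (M + outer a b) (y + c \<cdot>\<^sub>v a))"
  then have "i < l" "j < Suc n" using dims by simp_all
  then show "(append_col M y + outer a (vec_snoc b c)) $$ (i, j)
      = append_col (M + outer a b) (y + c \<cdot>\<^sub>v a) $$ (i, j)"
    using dims by (simp add: append_col_def vec_snoc_def index_outer conj_commute disj_commute)
qed (use assms in simp_all)

lemma append_col_mult_vec:
  fixes M :: "'a :: comm_semiring_1 Matrix.mat"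
  assumes "M \<in> carrier_mat l n" "y \<in> carrier_vec l" "q \<in> carrier_vec (Suc n)"
  shows "append_col M y *\<^sub>v q = M *\<^sub>v vec_first q n + (q $ n) \<cdot>\<^sub>v y"
proof (rule eq_vecI)
  fix i assume "i < dim_vec (M *\<^sub>v vec_first q n + (q $ n) \<cdot>\<^sub>v y)"
  then have i: "i < l" using assms by auto
  have "(append_col M y *\<^sub>v q) $ i = (\<Sum>j<Suc n. append_col M y $$ (i, j) * q $ j)"
    using i assms by (simp add: scalar_prod_def atLeast0LessThan del: sum.lessThan_Suc)
  also have "\<dots> = (\<Sum>j<n. M $$ (i, j) * q $ j) + y $ i * q $ n"
    using i assms by (simp add: index_append_col)
  also have "\<dots> = (M *\<^sub>v vec_first q n + (q $ n) \<cdot>\<^sub>v y) $ i"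
    using i assms by (auto simp: scalar_prod_def atLeast0LessThan vec_first_def mult.commute)
  finally show "(append_col M y *\<^sub>v q) $ i = (M *\<^sub>v vec_first q n + (q $ n) \<cdot>\<^sub>v y) $ i" .
qed (use assms in \<open>auto simp: append_col_def\<close>)

text \<open>A left constraint amounts to one scalar equation per column, so in this form an appended
  column adds exactly one equation.\<close>

lemma mat_of_row_mult_eq_iff:
  fixes A :: "'a :: semiring_0 Matrix.mat"
  assumes "s \<in> carrier_vec l" "A \<in> carrier_mat l n" "u \<in> carrier_vec n"
  shows "mat_of_row s * A = mat_of_row u \<longleftrightarrow> (\<forall>j<n. s \<bullet> col A j = u $ j)"
proof
  assume eq: "mat_of_row s * A = mat_of_row u"
  show "\<forall>j<n. s \<bullet> col A j = u $ j"
  proof (intro allI impI)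
    fix j assume "j < n"
    then show "s \<bullet> col A j = u $ j"
      using assms arg_cong[OF eq, of "\<lambda>B. B $$ (0, j)"] by auto
  qed
next
  assume "\<forall>j<n. s \<bullet> col A j = u $ j"
  then show "mat_of_row s * A = mat_of_row u"
    using assms by (intro eq_matI) auto
qed

lemma mat_of_row_mult_append_col_iff:
  fixes M :: "'a :: semiring_0 Matrix.mat"
  assumes "s \<in> carrier_vec l" "M \<in> carrier_mat l n" "y \<in> carrier_vec l" "u \<in> carrier_vec (Suc n)"
  shows "mat_of_row s * append_col M y = mat_of_row u \<longleftrightarrow>
    mat_of_row s * M = mat_of_row (vec_first u n) \<and> s \<bullet> y = u $ n"
proof -
  have "col (append_col M y) j = (if j < n then col M j else y)" if "j < Suc n" for j
    using that assms by (intro eq_vecI) (auto simp: append_col_def)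
  then show ?thesis
    using assms by (auto simp: mat_of_row_mult_eq_iff[of s l _ "Suc n"] mat_of_row_mult_eq_iff[of s l _ n]
        vec_first_def less_Suc_eq)
qed

text \<open>Associativity of the product of \<open>s\<close> transposed, \<open>M\<close> and
  \<open>z\<close>. For all \<open>M\<close> that satisfy a fixed left constraint, the scalar
  product of \<open>s\<close> with the image of \<open>z\<close> is therefore the same.\<close>

lemma scalar_prod_mult_mat_vec:
  fixes M :: "'a :: semiring_0 Matrix.mat"
  assumes "s \<in> carrier_vec l" "M \<in> carrier_mat l n" "u \<in> carrier_vec n" "z \<in> carrier_vec n"
    and eq: "mat_of_row s * M = mat_of_row u"
  shows "s \<bullet> (M *\<^sub>v z) = u \<bullet> z"
proof -
  have "mat_of_row s *\<^sub>v (M *\<^sub>v z) = mat_of_row u *\<^sub>v z"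
    unfolding eq[symmetric] using assms by (intro assoc_mult_mat_vec[symmetric]) auto
  then have "(mat_of_row s *\<^sub>v (M *\<^sub>v z)) $ 0 = (mat_of_row u *\<^sub>v z) $ 0" by simp
  then show ?thesis by simp
qed

text \<open>In characteristic 2 every vector is its own negative, so adding \<open>v\<close> is an
  involution. This serves in place of subtraction throughout.\<close>

lemma bit_vec_add_cancel:
  assumes "(v :: bit_vec) \<in> carrier_vec n" "w \<in> carrier_vec n"
  shows "v + (v + w) = w"
proof (rule eq_vecI)
  fix i assume "i < dim_vec w"
  then have "(v + (v + w)) $ i = v $ i + (v $ i + w $ i)" using assms by simp
  also have "\<dots> = w $ i" by (cases "v $ i"; cases "w $ i") simp_all
  finally show "(v + (v + w)) $ i = w $ i" .
qed (use assms in simp)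

lemma bit_vec_add_eq_iff:
  assumes "(v :: bit_vec) \<in> carrier_vec n" "w \<in> carrier_vec n" "t \<in> carrier_vec n"
  shows "v + w = t \<longleftrightarrow> v = t + w"
  using assms bit_vec_add_cancel[of w n v] bit_vec_add_cancel[of w n t]
  by (metis comm_add_vec add_carrier_vec)

subsection \<open>Nice sets of extended matrices\<close>

text \<open>When \<open>q $ n\<close> is 1, the part \<open>M *\<^sub>v z\<close> of the last column
  merges into the vector that multiplies \<open>M\<close>, and \<open>w\<close> moves to the
  right-hand side. Hypothesis \<open>c\<close> makes the new constraint independent of
  \<open>w\<close>: wherever \<open>w\<close> occurs it equals \<open>t0\<close>. The
  \<open>if\<close> keeps the right-hand side in dimension \<open>l\<close> although nothing is
  assumed about the dimension of \<open>t0\<close>.\<close>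

lemma right_constraint_append_col_iff:
  fixes M :: bit_mat
  assumes M: "M \<in> carrier_mat l n" and z: "z \<in> carrier_vec n" and w: "w \<in> carrier_vec l"
    and q: "q \<in> carrier_vec (Suc n)" and t: "t \<in> carrier_vec l"
    and c: "q $ n = 0 \<or> w = t0"
  shows "append_col M (M *\<^sub>v z + w) *\<^sub>v q = t \<longleftrightarrow>
    M *\<^sub>v (vec_first q n + (q $ n) \<cdot>\<^sub>v z) = t + (q $ n) \<cdot>\<^sub>v (if q $ n = 0 then 0\<^sub>v l else t0)"
proof -
  have Mz: "M *\<^sub>v z \<in> carrier_vec l" and Mq: "M *\<^sub>v vec_first q n \<in> carrier_vec l"
    using M z by auto
  have eq: "append_col M (M *\<^sub>v z + w) *\<^sub>v q
      = M *\<^sub>v vec_first q n + (q $ n) \<cdot>\<^sub>v (M *\<^sub>v z + w)"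
    using M q Mz w by (intro append_col_mult_vec) auto
  show ?thesis
  proof (cases "q $ n")
    case zero
    have "0 \<cdot>\<^sub>v (M *\<^sub>v z + w) = 0\<^sub>v l" "0 \<cdot>\<^sub>v z = 0\<^sub>v n" "0 \<cdot>\<^sub>v 0\<^sub>v l = (0\<^sub>v l :: bit_vec)"
      using M z w by (auto intro!: eq_vecI)
    then show ?thesis using zero M t Mq by (simp add: eq)
  next
    case one
    have "append_col M (M *\<^sub>v z + w) *\<^sub>v q = (M *\<^sub>v vec_first q n + M *\<^sub>v z) + w"
      using one Mq Mz w by (simp add: eq assoc_add_vec[of _ l])
    also have "M *\<^sub>v vec_first q n + M *\<^sub>v z = M *\<^sub>v (vec_first q n + z)"
      using M z by (intro mult_add_distrib_mat_vec[symmetric]) auto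
    finally have eq': "append_col M (M *\<^sub>v z + w) *\<^sub>v q = M *\<^sub>v (vec_first q n + z) + w" .
    have "M *\<^sub>v (vec_first q n + z) \<in> carrier_vec l" using M z by auto
    from bit_vec_add_eq_iff[OF this w t] have "append_col M (M *\<^sub>v z + w) *\<^sub>v q = t \<longleftrightarrow>
        M *\<^sub>v (vec_first q n + z) = t + w"
      unfolding eq' .
    then show ?thesis using one c by simp
  qed
qed

text \<open>Given the constraint on \<open>M\<close>, the product of \<open>p\<close> with
  \<open>M *\<^sub>v z\<close> is the constant \<open>vec_first u n \<bullet> z\<close>. What
  remains of the equation for the last column concerns \<open>w\<close> alone, so the conditions on
  \<open>M\<close> and on \<open>w\<close> separate.\<close>

lemma left_constraint_append_col_iff:
  fixes M :: bit_mat
  assumes M: "M \<in> carrier_mat l n" and z: "z \<in> carrier_vec n" and w: "w \<in> carrier_vec l"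
    and p: "p \<in> carrier_vec l" and u: "u \<in> carrier_vec (Suc n)"
  shows "mat_of_row p * append_col M (M *\<^sub>v z + w) = mat_of_row u \<longleftrightarrow>
    mat_of_row p * M = mat_of_row (vec_first u n) \<and> p \<bullet> w = u $ n + vec_first u n \<bullet> z"
proof -
  have Mz: "M *\<^sub>v z \<in> carrier_vec l" using M z by auto
  have "p \<bullet> (M *\<^sub>v z + w) = vec_first u n \<bullet> z + p \<bullet> w"
    if "mat_of_row p * M = mat_of_row (vec_first u n)"
    using scalar_prod_mult_mat_vec[OF p M _ z that] scalar_prod_add_distrib[OF p Mz w] by simp
  moreover have "a + b = d \<longleftrightarrow> b = d + a" for a b d :: bit
    by (cases a; cases b; cases d) simp_all
  moreover have "M *\<^sub>v z + w \<in> carrier_vec l" using Mz w by simp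
  ultimately show ?thesis
    using mat_of_row_mult_append_col_iff[OF p M _ u, of "M *\<^sub>v z + w"] by metis
qed

lemma nice_subset_carrier: "nice l n r T \<Longrightarrow> T \<subseteq> carrier_mat l n"
  by (auto simp: nice_def right_affine_def)

text \<open>In the coordinates \<open>M\<close> and \<open>w\<close>, where the last column is
  \<open>M *\<^sub>v z + w\<close>, a nice set becomes a product. Both kinds of constraint number at
  most \<open>r\<close>, so trivial constraints can pad each list to the common length
  \<open>R\<close>.\<close>

lemma nice_append_colE:
  assumes nice: "nice l (Suc n) r T" and "r \<le> R"
  obtains q t p s z W where
    "\<forall>i<R. q i \<in> carrier_vec n \<and> t i \<in> carrier_vec l \<and> p i \<in> carrier_vec l \<and> s i \<in> carrier_vec n"
    "z \<in> carrier_vec n" "W \<subseteq> carrier_vec l"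
    "\<forall>M \<in> carrier_mat l n. \<forall>w \<in> carrier_vec l. append_col M (M *\<^sub>v z + w) \<in> T \<longleftrightarrow>
       (\<forall>i<R. M *\<^sub>v q i = t i \<and> mat_of_row (p i) * M = mat_of_row (s i)) \<and> w \<in> W"
proof -
  obtain r1 r2 A B where r: "r1 + r2 = r" and "right_affine l (Suc n) r1 A"
    and "left_affine l (Suc n) r2 B" and AB: "T = A \<inter> B"
    using nice unfolding nice_def by (elim exE conjE)
  then obtain q t p u
    where qt': "\<forall>i<r1. q i \<in> carrier_vec (Suc n) \<and> t i \<in> carrier_vec l"
    and A: "A = {M \<in> carrier_mat l (Suc n). \<forall>i<r1. M *\<^sub>v q i = t i}"
    and pu': "\<forall>j<r2. p j \<in> carrier_vec l \<and> u j \<in> carrier_vec (Suc n)"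
    and B: "B = {M \<in> carrier_mat l (Suc n). \<forall>j<r2. mat_of_row (p j) * M = mat_of_row (u j)}"
    unfolding right_affine_def left_affine_def by (elim exE conjE)
  have qt: "\<And>i. i < r1 \<Longrightarrow> q i \<in> carrier_vec (Suc n)" "\<And>i. i < r1 \<Longrightarrow> t i \<in> carrier_vec l"
    and pu: "\<And>j. j < r2 \<Longrightarrow> p j \<in> carrier_vec l" "\<And>j. j < r2 \<Longrightarrow> u j \<in> carrier_vec (Suc n)"
    using qt' pu' by simp_all
  \<comment> \<open>A right constraint with last coordinate 1, solved for the last column, says that
    this column is \<open>M *\<^sub>v z + t0\<close>, with \<open>z\<close> the remaining
    coordinates and \<open>t0\<close> the right-hand side. Without such a constraint the choice is
    free, and zero vectors serve.\<close>
  have "\<exists>z t0. z \<in> carrier_vec n \<and> t0 \<in> carrier_vec l \<and>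
      ((\<exists>i<r1. q i $ n = 1 \<and> vec_first (q i) n = z \<and> t i = t0) \<or> (\<forall>i<r1. q i $ n = 0))"
  proof (cases "\<forall>i<r1. q i $ n = 0")
    case True
    then show ?thesis using zero_carrier_vec by blast
  next
    case False
    then obtain i where "i < r1" "q i $ n = 1" by auto
    then show ?thesis using qt(2)[of i]
      by (intro exI[of _ "vec_first (q i) n"] exI[of _ "t i"]) auto
  qed
  then obtain z t0 where z: "z \<in> carrier_vec n" and t0: "t0 \<in> carrier_vec l"
    and zt0: "(\<exists>i<r1. q i $ n = 1 \<and> vec_first (q i) n = z \<and> t i = t0) \<or> (\<forall>i<r1. q i $ n = 0)"
    by blast
  define W where "W = {w \<in> carrier_vec l.
    (\<forall>j<r2. p j \<bullet> w = u j $ n + vec_first (u j) n \<bullet> z) \<and> ((\<forall>i<r1. q i $ n = 0) \<or> w = t0)}"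
  \<comment> \<open>These are the right constraints after elimination of the last column. The
    constraint that supplied \<open>z\<close> and \<open>t0\<close> becomes trivial, as
    \<open>z + z\<close> and \<open>t0 + t0\<close> vanish. Indices from \<open>r1\<close> on are
    padding.\<close>
  define q' where "q' i = (if i < r1 then vec_first (q i) n + (q i $ n) \<cdot>\<^sub>v z else 0\<^sub>v n)" for i
  define t' where "t' i = (if i < r1 then t i + (q i $ n) \<cdot>\<^sub>v (if q i $ n = 0 then 0\<^sub>v l else t0)
    else 0\<^sub>v l)" for i
  define p' where "p' j = (if j < r2 then p j else 0\<^sub>v l)" for j
  define s' where "s' j = (if j < r2 then vec_first (u j) n else 0\<^sub>v n)" for j
  show thesis
  proof (rule that)
    show "\<forall>i<R. q' i \<in> carrier_vec n \<and> t' i \<in> carrier_vec l \<and> p' i \<in> carrier_vec l \<and> s' i \<in> carrier_vec n"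
      using z t0 qt pu by (simp add: q'_def t'_def p'_def s'_def)
    show "z \<in> carrier_vec n" by (rule z)
    show "W \<subseteq> carrier_vec l" by (auto simp: W_def)
    show "\<forall>M \<in> carrier_mat l n. \<forall>w \<in> carrier_vec l. append_col M (M *\<^sub>v z + w) \<in> T \<longleftrightarrow>
        (\<forall>i<R. M *\<^sub>v q' i = t' i \<and> mat_of_row (p' i) * M = mat_of_row (s' i)) \<and> w \<in> W"
    proof (intro ballI)
      fix M :: bit_mat and w :: bit_vec
      assume M: "M \<in> carrier_mat l n" and w: "w \<in> carrier_vec l"
      let ?A = "append_col M (M *\<^sub>v z + w)"
      have Aug: "?A \<in> carrier_mat l (Suc n)" using M by simp
      \<comment> \<open>Applied to \<open>?A\<close>, the constraint that supplied \<open>z\<close>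
        yields \<open>M *\<^sub>v z\<close> twice plus \<open>w\<close>, hence
        \<open>w\<close>.\<close>
      have w_t0: "(\<forall>i<r1. q i $ n = 0) \<or> w = t0" if *: "\<forall>i<r1. ?A *\<^sub>v q i = t i"
        using zt0
      proof
        assume "\<exists>i<r1. q i $ n = 1 \<and> vec_first (q i) n = z \<and> t i = t0"
        then obtain i where i: "i < r1" "q i $ n = 1" "vec_first (q i) n = z" "t i = t0" by blast
        have Mz: "M *\<^sub>v z \<in> carrier_vec l" using M z by simp
        have "t0 = ?A *\<^sub>v q i" using * i(1,4) by simp
        also have "\<dots> = M *\<^sub>v z + (M *\<^sub>v z + w)"
          using append_col_mult_vec[OF M add_carrier_vec[OF Mz w] qt(1)[OF i(1)]]
          unfolding i(2,3) by simp
        also have "\<dots> = w" by (rule bit_vec_add_cancel[OF Mz w])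
        finally show ?thesis by simp
      qed simp
      have right: "(\<forall>i<r1. ?A *\<^sub>v q i = t i) \<longleftrightarrow> (\<forall>i<r1. M *\<^sub>v q' i = t' i)"
        if *: "(\<forall>i<r1. q i $ n = 0) \<or> w = t0"
      proof -
        have "?A *\<^sub>v q i = t i \<longleftrightarrow> M *\<^sub>v q' i = t' i" if i: "i < r1" for i
        proof -
          have "q i $ n = 0 \<or> w = t0" using * i by blast
          from right_constraint_append_col_iff[OF M z w qt(1)[OF i] qt(2)[OF i] this]
          show ?thesis using i by (simp add: q'_def t'_def)
        qed
        then show ?thesis by blast
      qed
      have left: "mat_of_row (p j) * ?A = mat_of_row (u j) \<longleftrightarrow>
          mat_of_row (p' j) * M = mat_of_row (s' j) \<and> p j \<bullet> w = u j $ n + vec_first (u j) n \<bullet> z"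
        if "j < r2" for j
        using left_constraint_append_col_iff[OF M z w pu(1)[OF that] pu(2)[OF that]] that
        by (simp add: p'_def s'_def)
      have "M *\<^sub>v 0\<^sub>v n = 0\<^sub>v l" using M by (intro eq_vecI) auto
      then have pad_right: "(\<forall>i<R. M *\<^sub>v q' i = t' i) \<longleftrightarrow> (\<forall>i<r1. M *\<^sub>v q' i = t' i)"
        using r \<open>r \<le> R\<close> by (auto simp: q'_def t'_def)
      have "mat_of_row (0\<^sub>v l) * M = mat_of_row (0\<^sub>v n)"
        using M by (simp add: mat_of_row_mult_eq_iff[of _ l _ n])
      then have pad_left: "(\<forall>i<R. mat_of_row (p' i) * M = mat_of_row (s' i)) \<longleftrightarrow>
          (\<forall>i<r2. mat_of_row (p' i) * M = mat_of_row (s' i))"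
        using r \<open>r \<le> R\<close> by (auto simp: p'_def s'_def)
      have "?A \<in> T \<longleftrightarrow> (\<forall>i<r1. ?A *\<^sub>v q i = t i) \<and> (\<forall>j<r2. mat_of_row (p j) * ?A = mat_of_row (u j))"
        unfolding AB A B using Aug by simp
      \<comment> \<open>The equivalence \<open>right\<close> needs the disjunction about
        \<open>w\<close>. From left to right \<open>w_t0\<close> supplies it; from right to left it
        is assumed.\<close>
      moreover have "(\<forall>i<r1. ?A *\<^sub>v q i = t i) \<longleftrightarrow>
          (\<forall>i<r1. M *\<^sub>v q' i = t' i) \<and> ((\<forall>i<r1. q i $ n = 0) \<or> w = t0)"
        using w_t0 right by argo
      moreover have "(\<forall>j<r2. mat_of_row (p j) * ?A = mat_of_row (u j)) \<longleftrightarrow>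
          (\<forall>j<r2. mat_of_row (p' j) * M = mat_of_row (s' j)) \<and>
          (\<forall>j<r2. p j \<bullet> w = u j $ n + vec_first (u j) n \<bullet> z)"
        using left by (simp add: all_conj_distrib imp_conjR cong: imp_cong)
      moreover have "(\<forall>i<R. M *\<^sub>v q' i = t' i \<and> mat_of_row (p' i) * M = mat_of_row (s' i)) \<longleftrightarrow>
          (\<forall>i<r1. M *\<^sub>v q' i = t' i) \<and> (\<forall>i<r2. mat_of_row (p' i) * M = mat_of_row (s' i))"
        unfolding pad_right[symmetric] pad_left[symmetric] by blast
      ultimately show "?A \<in> T \<longleftrightarrow>
          (\<forall>i<R. M *\<^sub>v q' i = t' i \<and> mat_of_row (p' i) * M = mat_of_row (s' i)) \<and> w \<in> W"
        using w unfolding W_def mem_Collect_eq by argo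
    qed
  qed
qed

subsection \<open>From the graph of \<open>F\<close> to an affine function\<close>

lemma inj_on_graph:
  assumes "F \<in> carrier_mat l n \<rightarrow> carrier_vec l"
  shows "inj_on (\<lambda>M. append_col M (F M)) (carrier_mat l n)"
proof (rule inj_onI)
  fix M M' assume M: "M \<in> carrier_mat l n" "M' \<in> carrier_mat l n"
    and eq: "append_col M (F M) = append_col M' (F M')"
  from append_col_inject[OF M funcset_mem[OF assms M(1)] funcset_mem[OF assms M(2)] eq]
  show "M = M'" ..
qed

text \<open>Each successful triple for \<open>F\<close> extends by a suitable last bit of
  \<open>b\<close> to a successful triple for \<open>S\<close>. The extension is injective, while
  the sample space doubles.\<close>

lemma graph_shortcode_test:
  fixes F :: "bit_mat \<Rightarrow> bit_vec"
  assumes F: "F \<in> carrier_mat l n \<rightarrow> carrier_vec l"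
    and S: "S = (\<lambda>M. append_col M (F M)) ` carrier_mat l n"
  shows "\<P>((M, a, b) in pair_pmf (pmf_of_set (carrier_mat l n))
             (pair_pmf (pmf_of_set (carrier_vec l)) (pmf_of_set (carrier_vec n))).
           F (M + outer a b) \<in> {F M, F M + a}) / 2
       \<le> \<P>((M, a, b) in pair_pmf (pmf_of_set S)
             (pair_pmf (pmf_of_set (carrier_vec l)) (pmf_of_set (carrier_vec (Suc n)))).
           M + outer a b \<in> S)"
proof -
  define X where "X = {x \<in> carrier_mat l n \<times> carrier_vec l \<times> carrier_vec n.
    case x of (M, a, b) \<Rightarrow> F (M + outer a b) \<in> {F M, F M + a}}"
  define Y where "Y = {x \<in> S \<times> carrier_vec l \<times> carrier_vec (Suc n).
    case x of (M, a, b) \<Rightarrow> M + outer a b \<in> S}"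
  \<comment> \<open>The added bit records which alternative of the test occurred: 0 if
    \<open>F\<close> keeps its value, 1 if the value moves by \<open>a\<close>.\<close>
  define f where "f = (\<lambda>(M, a, b). (append_col M (F M), a,
    vec_snoc b (if F (M + outer a b) = F M then 0 else 1)))"
  have S_fin: "finite S" "S \<noteq> {}" unfolding S using finite_nonempty_carriers by auto
  have card_S: "card S = card (carrier_mat l n :: bit_mat set)"
    unfolding S by (rule card_image[OF inj_on_graph[OF F]])
  have finY: "finite Y"
  proof (rule finite_subset)
    show "Y \<subseteq> S \<times> carrier_vec l \<times> carrier_vec (Suc n)" unfolding Y_def by blast
    show "finite (S \<times> (carrier_vec l :: bit_vec set) \<times> (carrier_vec (Suc n) :: bit_vec set))"
      by (intro finite_cartesian_product S_fin finite_carrier_bit_vec)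
  qed
  have "inj_on f X"
  proof (rule inj_onI)
    fix x x' assume xx: "x \<in> X" "x' \<in> X" and eq: "f x = f x'"
    obtain M a b M' a' b' where x: "x = (M, a, b)" "x' = (M', a', b')"
      by (metis prod.exhaust)
    have c: "M \<in> carrier_mat l n" "M' \<in> carrier_mat l n" "b \<in> carrier_vec n" "b' \<in> carrier_vec n"
      using xx by (auto simp: X_def x)
    have e1: "append_col M (F M) = append_col M' (F M')"
      and e2: "vec_snoc b (if F (M + outer a b) = F M then 0 else 1)
     = vec_snoc b' (if F (M' + outer a' b') = F M' then 0 else 1)" and a: "a = a'"
      using eq unfolding f_def x prod.case prod.inject by blast+
    have "M = M'" by (rule inj_onD[OF inj_on_graph[OF F] e1 c(1,2)])
    moreover have "b = b'" using vec_snoc_inject[OF c(3,4) e2] ..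
    ultimately show "x = x'" using a by (simp add: x)
  qed
  moreover have "f ` X \<subseteq> Y"
  proof
    fix y assume "y \<in> f ` X"
    then obtain M a b where c: "M \<in> carrier_mat l n" "a \<in> carrier_vec l" "b \<in> carrier_vec n"
      and Fab: "F (M + outer a b) \<in> {F M, F M + a}" and y: "y = f (M, a, b)"
      by (auto simp: X_def)
    let ?c = "if F (M + outer a b) = F M then 0 else 1 :: bit"
    have FM: "F M \<in> carrier_vec l" using F c by auto
    have Mab: "M + outer a b \<in> carrier_mat l n" using c by simp
    have "F M + ?c \<cdot>\<^sub>v a = F (M + outer a b)"
    proof (cases "F (M + outer a b) = F M")
      case True
      have "0 \<cdot>\<^sub>v a = 0\<^sub>v l" using c by (intro eq_vecI) auto
      then show ?thesis using True FM by simp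
    next
      case False
      then show ?thesis using Fab by simp
    qed
    then have "append_col M (F M) + outer a (vec_snoc b ?c)
        = append_col (M + outer a b) (F (M + outer a b))"
      using append_col_add_outer[OF c(1) FM c(2,3), of ?c] by simp
    then have "append_col M (F M) + outer a (vec_snoc b ?c) \<in> S"
      unfolding S by (rule image_eqI[OF _ Mab])
    then show "y \<in> Y"
      using c by (auto simp: Y_def y f_def S)
  qed
  ultimately have XY: "card X \<le> card Y"
    by (rule card_inj_on_le[OF _ _ finY])
  have pX: "\<P>((M, a, b) in pair_pmf (pmf_of_set (carrier_mat l n))
             (pair_pmf (pmf_of_set (carrier_vec l)) (pmf_of_set (carrier_vec n))).
           F (M + outer a b) \<in> {F M, F M + a})
      = real (card X) / real (card ((carrier_mat l n :: bit_mat set) \<times> (carrier_vec l :: bit_vec set) \<times> (carrier_vec n :: bit_vec set)))"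
    unfolding X_def by (intro prob_pmf_of_set_triple finite_nonempty_carriers)
  have pY: "\<P>((M, a, b) in pair_pmf (pmf_of_set S)
             (pair_pmf (pmf_of_set (carrier_vec l)) (pmf_of_set (carrier_vec (Suc n)))).
           M + outer a b \<in> S)
      = real (card Y) / real (card (S \<times> (carrier_vec l :: bit_vec set) \<times> (carrier_vec (Suc n) :: bit_vec set)))"
    unfolding Y_def by (intro prob_pmf_of_set_triple finite_nonempty_carriers S_fin)
  \<comment> \<open>The graph has as many elements as there are matrices \<open>M\<close>, so only
    the extra bit enlarges the sample space.\<close>
  have "card (S \<times> (carrier_vec l :: bit_vec set) \<times> (carrier_vec (Suc n) :: bit_vec set))
      = 2 * card ((carrier_mat l n :: bit_mat set) \<times> (carrier_vec l :: bit_vec set) \<times> (carrier_vec n :: bit_vec set))"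
    by (simp add: card_cartesian_product card_S card_carrier_bit_vec_Suc)
  then show ?thesis
    unfolding pX pY using XY by (simp add: divide_right_mono mult.commute)
qed

text \<open>The set \<open>T\<close> is parametrised by pairs from \<open>D\<close> and
  \<open>W\<close>, and a point of the graph lies in \<open>T\<close> only if \<open>F M\<close> is
  \<open>M *\<^sub>v z + w\<close> for some \<open>w\<close> in \<open>W\<close>. Averaging over
  \<open>W\<close> gives one offset at which the density is at least \<delta>.\<close>

lemma affine_agreement:
  fixes F :: "bit_mat \<Rightarrow> bit_vec" and \<delta> :: real
  assumes F: "F \<in> carrier_mat l n \<rightarrow> carrier_vec l"
    and S: "S = (\<lambda>M. append_col M (F M)) ` carrier_mat l n"
    and nice: "nice l (Suc n) r T" and T: "T \<noteq> {}"
    and dens: "real (card (S \<inter> T)) \<ge> \<delta> * real (card T)" and "r \<le> R"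
  shows "\<exists>q t p s z u.
     (\<forall>i<R. q i \<in> carrier_vec n \<and> t i \<in> carrier_vec l \<and>
            p i \<in> carrier_vec l \<and> s i \<in> carrier_vec n) \<and>
     z \<in> carrier_vec n \<and> u \<in> carrier_vec l \<and>
     \<P>(M in pmf_of_set (carrier_mat l n).
        F M = M *\<^sub>v z + u \<bar>
        (\<forall>i<R. M *\<^sub>v q i = t i \<and> mat_of_row (p i) * M = mat_of_row (s i))) \<ge> \<delta>"
proof -
  obtain q t p s z W where
    carr: "\<forall>i<R. q i \<in> carrier_vec n \<and> t i \<in> carrier_vec l \<and> p i \<in> carrier_vec l \<and> s i \<in> carrier_vec n"
    and z: "z \<in> carrier_vec n" and W: "W \<subseteq> carrier_vec l"
    and mem: "\<forall>M \<in> carrier_mat l n. \<forall>w \<in> carrier_vec l. append_col M (M *\<^sub>v z + w) \<in> T \<longleftrightarrow>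
       (\<forall>i<R. M *\<^sub>v q i = t i \<and> mat_of_row (p i) * M = mat_of_row (s i)) \<and> w \<in> W"
    by (rule nice_append_colE[OF nice \<open>r \<le> R\<close>])
  let ?C = "\<lambda>M. \<forall>i<R. M *\<^sub>v q i = t i \<and> mat_of_row (p i) * M = mat_of_row (s i)"
  define D where "D = {M \<in> carrier_mat l n. ?C M}"
  define E where "E w = {M \<in> D. F M = M *\<^sub>v z + w}" for w
  have finD: "finite D" unfolding D_def using finite_carrier_bit_mat by simp
  have finW: "finite W" using W finite_carrier_bit_vec finite_subset by blast
  have Mz: "M *\<^sub>v z \<in> carrier_vec l" if "M \<in> carrier_mat l n" for M
    using that z by simp
  have cancel: "v = M *\<^sub>v z + (M *\<^sub>v z + v)" if "M \<in> carrier_mat l n" "v \<in> carrier_vec l" for M v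
    using bit_vec_add_cancel[OF Mz[OF that(1)] that(2)] by simp
  have T_eq: "T = (\<lambda>(M, w). append_col M (M *\<^sub>v z + w)) ` (D \<times> W)"
  proof (intro equalityI subsetI)
    fix A assume A: "A \<in> T"
    then have "A \<in> carrier_mat l (Suc n)" using nice_subset_carrier[OF nice] by blast
    then obtain M y where My: "M \<in> carrier_mat l n" "y \<in> carrier_vec l" "A = append_col M y"
      by (rule append_col_cases)
    \<comment> \<open>The offset is the difference between the last column and
      \<open>M *\<^sub>v z\<close>, written as a sum over F_2.\<close>
    define w where "w = M *\<^sub>v z + y"
    have w: "w \<in> carrier_vec l" using Mz[OF My(1)] My(2) by (simp add: w_def)
    have A_eq: "A = append_col M (M *\<^sub>v z + w)"
      unfolding w_def using cancel[OF My(1,2)] My(3) by simp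
    have "M \<in> D" "w \<in> W"
      using A mem[rule_format, OF My(1) w] My(1) unfolding A_eq D_def by blast+
    then show "A \<in> (\<lambda>(M, w). append_col M (M *\<^sub>v z + w)) ` (D \<times> W)"
      using A_eq by force
  next
    fix A assume "A \<in> (\<lambda>(M, w). append_col M (M *\<^sub>v z + w)) ` (D \<times> W)"
    then obtain M w where "M \<in> D" "w \<in> W" and A: "A = append_col M (M *\<^sub>v z + w)" by auto
    then show "A \<in> T" unfolding A using mem W unfolding D_def by blast
  qed
  have "inj_on (\<lambda>(M, w). append_col M (M *\<^sub>v z + w)) (D \<times> W)"
  proof (rule inj_onI, clarify)
    fix M w M' w' assume c: "M \<in> D" "w \<in> W" "M' \<in> D" "w' \<in> W"
      and eq: "append_col M (M *\<^sub>v z + w) = append_col M' (M' *\<^sub>v z + w')"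
    have M: "M \<in> carrier_mat l n" "M' \<in> carrier_mat l n" and w: "w \<in> carrier_vec l" "w' \<in> carrier_vec l"
      using c W by (auto simp: D_def)
    have MM: "M = M'" and e: "M *\<^sub>v z + w = M' *\<^sub>v z + w'"
      using append_col_inject[OF M add_carrier_vec[OF Mz[OF M(1)] w(1)]
          add_carrier_vec[OF Mz[OF M(2)] w(2)] eq] by blast+
    have "w = M *\<^sub>v z + (M *\<^sub>v z + w)" by (rule cancel[OF M(1) w(1)])
    also have "\<dots> = M *\<^sub>v z + (M *\<^sub>v z + w')" unfolding e unfolding MM ..
    also have "\<dots> = w'" by (rule cancel[OF M(1) w(2), symmetric])
    finally show "M = M' \<and> w = w'" using MM by simp
  qed
  then have card_T: "card T = card D * card W"
    unfolding T_eq by (simp add: card_image card_cartesian_product)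
  have "S \<inter> T \<subseteq> (\<lambda>M. append_col M (F M)) ` (\<Union>w\<in>W. E w)"
  proof
    fix A assume A: "A \<in> S \<inter> T"
    then obtain M where M: "M \<in> carrier_mat l n" and A_eq: "A = append_col M (F M)"
      unfolding S by blast
    have FM: "F M \<in> carrier_vec l" using F M by blast
    have w: "M *\<^sub>v z + F M \<in> carrier_vec l" using Mz[OF M] FM by simp
    have "append_col M (M *\<^sub>v z + (M *\<^sub>v z + F M)) \<in> T"
      using A A_eq cancel[OF M FM] by simp
    then have "M \<in> D" "M *\<^sub>v z + F M \<in> W"
      using mem[rule_format, OF M w] M unfolding D_def by blast+
    then have "M \<in> (\<Union>w\<in>W. E w)"
      unfolding E_def using cancel[OF M FM] by blast
    then show "A \<in> (\<lambda>M. append_col M (F M)) ` (\<Union>w\<in>W. E w)" using A_eq by blast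
  qed
  moreover have finE: "finite (\<Union>w\<in>W. E w)" using finW finD by (simp add: E_def)
  ultimately have "card (S \<inter> T) \<le> card (\<Union>w\<in>W. E w)"
    by (meson card_image_le card_mono finite_imageI le_trans)
  \<comment> \<open>Only an upper bound is required here, so disjointness of the sets
    \<open>E w\<close> need not be shown.\<close>
  also have "\<dots> \<le> (\<Sum>w\<in>W. card (E w))" by (rule card_UN_le[OF finW])
  finally have "real (card (S \<inter> T)) \<le> (\<Sum>w\<in>W. real (card (E w)))"
    by (simp flip: of_nat_sum)
  then have sum: "\<delta> * real (card D) * real (card W) \<le> (\<Sum>w\<in>W. real (card (E w)))"
    using dens card_T by (simp add: mult.assoc)
  \<comment> \<open>Nonemptiness of \<open>W\<close> makes the averaging inequality strict; that of
    \<open>D\<close> allows division by \<open>card D\<close>.\<close>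
  have ne: "D \<noteq> {}" "W \<noteq> {}" using T T_eq by auto
  have "\<exists>w\<in>W. \<delta> * real (card D) \<le> real (card (E w))"
  proof (rule ccontr)
    assume "\<not> ?thesis"
    then have "(\<Sum>w\<in>W. real (card (E w))) < (\<Sum>w\<in>W. \<delta> * real (card D))"
      using finW ne by (intro sum_strict_mono) auto
    then show False using sum by (simp add: mult.commute)
  qed
  then obtain u where u: "u \<in> W" and *: "\<delta> * real (card D) \<le> real (card (E u))" by blast
  have "{M \<in> carrier_mat l n. F M = M *\<^sub>v z + u \<and> ?C M} = E u"
    by (auto simp: E_def D_def)
  then have "\<P>(M in pmf_of_set (carrier_mat l n). F M = M *\<^sub>v z + u \<bar> ?C M)
      = real (card (E u)) / real (card D)"
    by (simp only: cond_prob_pmf_of_set[OF finite_carrier_bit_mat carrier_mat_nonempty] D_def)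
  also have "\<dots> \<ge> \<delta>"
    using * ne finD by (simp add: pos_le_divide_eq card_gt_0_iff)
  finally have "\<delta> \<le> \<P>(M in pmf_of_set (carrier_mat l n). F M = M *\<^sub>v z + u \<bar> ?C M)" .
  moreover have "u \<in> carrier_vec l" using u W by blast
  ultimately show ?thesis using carr z by blast
qed

section \<open>Deduction of the soundness hypothesis from the inverse hypothesis\<close>

theorem theorem1:
  assumes "inverse_shortcode_hypothesis"
  shows "degree2_shortcode_soundness_hypothesis"
  unfolding degree2_shortcode_soundness_hypothesis_def
proof (intro allI impI)
  fix \<delta> :: real assume "\<delta> > 0"
  then have "\<delta> / 2 > 0" by simp
  from assms[unfolded inverse_shortcode_hypothesis_def, rule_format, OF this]
  obtain \<epsilon> :: real and r where \<epsilon>: "\<epsilon> > 0" and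
    ish: "\<forall>l n. \<forall>S \<subseteq> carrier_mat l n. S \<noteq> {} \<longrightarrow>
      \<P>((M, a, b) in pair_pmf (pmf_of_set S)
           (pair_pmf (pmf_of_set (carrier_vec l)) (pmf_of_set (carrier_vec n))).
         M + outer a b \<in> S) \<ge> \<delta> / 2 \<longrightarrow>
      (\<exists>T. nice l n r T \<and> T \<noteq> {} \<and> real (card (S \<inter> T)) \<ge> \<epsilon> * real (card T))"
    by (elim exE conjE)
  \<comment> \<open>The count \<open>Suc r\<close> is used because the conclusion asks for a
    positive number of constraints, while the inverse hypothesis may return
    \<open>r = 0\<close>.\<close>
  have main: "\<exists>q t p s z u.
     (\<forall>i<Suc r. q i \<in> carrier_vec n \<and> t i \<in> carrier_vec l \<and>
            p i \<in> carrier_vec l \<and> s i \<in> carrier_vec n) \<and>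
     z \<in> carrier_vec n \<and> u \<in> carrier_vec l \<and>
     \<P>(M in pmf_of_set (carrier_mat l n).
        F M = M *\<^sub>v z + u \<bar>
        (\<forall>i<Suc r. M *\<^sub>v q i = t i \<and> mat_of_row (p i) * M = mat_of_row (s i))) \<ge> \<epsilon>"
    if F: "F \<in> carrier_mat l n \<rightarrow> carrier_vec l"
      and test: "\<P>((M, a, b) in pair_pmf (pmf_of_set (carrier_mat l n))
               (pair_pmf (pmf_of_set (carrier_vec l)) (pmf_of_set (carrier_vec n))).
             F (M + outer a b) \<in> {F M, F M + a}) \<ge> \<delta>" for l n F
  proof -
    define S where "S = (\<lambda>M. append_col M (F M)) ` carrier_mat l n"
    have S: "S \<subseteq> carrier_mat l (Suc n)" "S \<noteq> {}"
      using carrier_mat_nonempty by (auto simp: S_def)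
    have "\<P>((M, a, b) in pair_pmf (pmf_of_set S)
             (pair_pmf (pmf_of_set (carrier_vec l)) (pmf_of_set (carrier_vec (Suc n)))).
           M + outer a b \<in> S) \<ge> \<delta> / 2"
      using graph_shortcode_test[OF F S_def] test by linarith
    \<comment> \<open>The inverse hypothesis is uniform in the dimensions, so it applies to matrices
      with \<open>Suc n\<close> columns with the same \<epsilon> and \<open>r\<close>.\<close>
    from ish[rule_format, OF S this] obtain T where
      T: "nice l (Suc n) r T" "T \<noteq> {}" "real (card (S \<inter> T)) \<ge> \<epsilon> * real (card T)"
      by blast
    show ?thesis by (rule affine_agreement[OF F S_def T]) simp
  qed
  show "\<exists>\<epsilon>::real. \<exists>r::nat. \<epsilon> > 0 \<and> r > 0 \<and>
       (\<forall>l. \<exists>n0. \<forall>n \<ge> n0. \<forall>F \<in> carrier_mat l n \<rightarrow> carrier_vec l.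
          \<P>((M, a, b) in pair_pmf (pmf_of_set (carrier_mat l n))
               (pair_pmf (pmf_of_set (carrier_vec l)) (pmf_of_set (carrier_vec n))).
             F (M + outer a b) \<in> {F M, F M + a}) \<ge> \<delta> \<longrightarrow>
          (\<exists>q t p s z u.
             (\<forall>i<r. q i \<in> carrier_vec n \<and> t i \<in> carrier_vec l \<and>
                    p i \<in> carrier_vec l \<and> s i \<in> carrier_vec n) \<and>
             z \<in> carrier_vec n \<and> u \<in> carrier_vec l \<and>
             \<P>(M in pmf_of_set (carrier_mat l n).
                F M = M *\<^sub>v z + u \<bar>
                (\<forall>i<r. M *\<^sub>v q i = t i \<and> mat_of_row (p i) * M = mat_of_row (s i))) \<ge> \<epsilon>))"
  \<comment> \<open>The threshold for \<open>n\<close> can be 0, since \<open>main\<close> holds for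
    all \<open>l\<close> and \<open>n\<close>.\<close>
  proof (rule exI[of _ \<epsilon>], rule exI[of _ "Suc r"], rule conjI[OF \<epsilon>], rule conjI[OF zero_less_Suc],
      rule allI, rule exI[of _ 0], rule allI, rule impI, rule ballI, rule impI)
  qed (rule main)
qed

end
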